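(* Let $G$ be a uniquely $C_4^{+}$-saturated graph on $n$ vertices with $k\geq 2$ triangles, let $A$ be the set of all vertices of $G$ that lie in some triangle of $G$, and let $t=\min\{k-|N_G(u)\cap A| : u\in N(A)\}$. Then $n\leq \frac{1}{2}k^{2}+\frac{10t+5}{2}k+\frac{25t^{2}+7t}{2}+1$.
   Context: All graphs are finite, simple and undirected. $C_4^{+}$ (the diamond) is the graph obtained from a $4$-cycle by adding one chord, i.e. $K_4$ minus an edge. For a graph $H$, a graph $G$ is uniquely $H$-saturated if $G$ contains no subgraph isomorphic to $H$, but for every pair of non-adjacent vertices $u,v$ of $G$, the graph $G+uv$ contains exactly one subgraph isomorphic to $H$. A triangle is a subgraph isomorphic to $K_3$. $N_G(u)$ is the neighborhood of $u$. For $U\subseteq V(G)$, $N(U)$ is the set of vertices not in $U$ having a neighbor in $U$ (vertices at distance exactly $1$ from $U$). *)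

theory Defs
  imports Complex_Main
begin

record 'a graph =
  vertices :: "'a set"
  edges :: "'a set set"

definition simple_graph :: "'a graph \<Rightarrow> bool" where
  "simple_graph G \<longleftrightarrow> finite (vertices G) \<and> (\<forall>e\<in>edges G. e \<subseteq> vertices G \<and> card e = 2)"

definition adjacent :: "'a graph \<Rightarrow> 'a \<Rightarrow> 'a \<Rightarrow> bool" where
  "adjacent G u v \<longleftrightarrow> {u, v} \<in> edges G"

definition neighborhood :: "'a graph \<Rightarrow> 'a \<Rightarrow> 'a set" where
  "neighborhood G u = {v \<in> vertices G. adjacent G u v}"

definition set_neighborhood :: "'a graph \<Rightarrow> 'a set \<Rightarrow> 'a set" where
  "set_neighborhood G U = {v \<in> vertices G. v \<notin> U \<and> (\<exists>u\<in>U. adjacent G u v)}"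

definition add_edge :: "'a graph \<Rightarrow> 'a \<Rightarrow> 'a \<Rightarrow> 'a graph" where
  "add_edge G u v = \<lparr>vertices = vertices G, edges = insert {u, v} (edges G)\<rparr>"

definition subgraph :: "'a graph \<Rightarrow> 'a graph \<Rightarrow> bool" where
  "subgraph S G \<longleftrightarrow> simple_graph S \<and> vertices S \<subseteq> vertices G \<and> edges S \<subseteq> edges G"

definition graph_isomorphic :: "'a graph \<Rightarrow> 'b graph \<Rightarrow> bool" where
  "graph_isomorphic G H \<longleftrightarrow> (\<exists>f. bij_betw f (vertices G) (vertices H) \<and>
     (\<forall>u\<in>vertices G. \<forall>v\<in>vertices G. adjacent G u v \<longleftrightarrow> adjacent H (f u) (f v)))"

text \<open>Subgraphs are not required to be induced; two copies are the same iff they have the same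
  vertices and the same edges.\<close>

definition copies :: "'b graph \<Rightarrow> 'a graph \<Rightarrow> 'a graph set" where
  "copies H G = {S. subgraph S G \<and> graph_isomorphic S H}"

definition uniquely_saturated :: "'b graph \<Rightarrow> 'a graph \<Rightarrow> bool" where
  "uniquely_saturated H G \<longleftrightarrow> copies H G = {} \<and>
     (\<forall>u\<in>vertices G. \<forall>v\<in>vertices G. u \<noteq> v \<and> \<not> adjacent G u v
        \<longrightarrow> card (copies H (add_edge G u v)) = 1)"

definition triangle :: "nat graph" where
  "triangle = \<lparr>vertices = {0, 1, 2}, edges = {{0, 1}, {1, 2}, {2, 0}}\<rparr>"

text \<open>The 4-cycle 0, 1, 2, 3 together with the chord between 0 and 2.\<close>

definition diamond :: "nat graph" where
  "diamond = \<lparr>vertices = {0, 1, 2, 3}, edges = {{0, 1}, {1, 2}, {2, 3}, {3, 0}, {0, 2}}\<rparr>"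

definition triangle_vertices :: "'a graph \<Rightarrow> 'a set" where
  "triangle_vertices G = (\<Union>T\<in>copies triangle G. vertices T)"

end

theory Submission
  imports Defs
begin

text \<open>
  Diamond-freeness and unique saturation say that a nonadjacent pair has either exactly two common
  neighbours, all four edges to them being \<^emph>\<open>free\<close> (in no triangle), or exactly one common
  neighbour, exactly one of the two edges to it lying in a triangle. Hence triangles are pairwise
  vertex-disjoint and a vertex outside \<open>A\<close> has at most one neighbour in each of them.

  For \<open>u \<notin> A\<close> of degree \<open>D\<close> with \<open>a\<close> neighbours in \<open>A\<close>, the vertices nonadjacent to \<open>u\<close> are
  counted by pairs of neighbours of \<open>u\<close> and by the \<open>2a\<close> triangle mates of its neighbours in \<open>A\<close>,
  so \<open>n \<le> 1 + D + (D choose 2) + 2a\<close>. It remains to bound \<open>D\<close>. If every neighbour of \<open>u\<close> outside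
  \<open>A\<close> has itself a neighbour in \<open>A\<close>, that neighbour lies in one of the \<open>t\<close> triangles missed by
  \<open>u\<close>; each of the \<open>3t\<close> vertices of these has two common neighbours with \<open>u\<close>, so there are at
  most \<open>6t\<close> such neighbours and \<open>D \<le> k + 5t\<close>.

  The missing ingredient is an analysis of the free degree: it is constant along free edges, and
  for a free edge \<open>xy\<close> and a triangle mate \<open>z\<close> of \<open>y\<close> a double count compares the free degrees of
  \<open>x\<close> and \<open>z\<close>. The comparison also shows that \<open>A\<close> is not the whole vertex set, without which the
  minimum defining \<open>t\<close> would range over the empty set.
\<close>

section \<open>Unique saturation as a condition on common neighbours\<close>

definition triangle_edge :: "('a \<Rightarrow> 'a \<Rightarrow> bool) \<Rightarrow> 'a \<Rightarrow> 'a \<Rightarrow> bool" where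
  "triangle_edge E x y \<longleftrightarrow> E x y \<and> (\<exists>z. E x z \<and> E y z)"

definition common_neighbors :: "('a \<Rightarrow> 'a \<Rightarrow> bool) \<Rightarrow> 'a \<Rightarrow> 'a \<Rightarrow> 'a set" where
  "common_neighbors E x y = {w. E x w \<and> E y w}"

lemma card_two_other:
  assumes "card S = 2" "x \<in> S"
  obtains y where "S = {x, y}" "y \<noteq> x"
proof -
  obtain a b where "S = {a, b}" "a \<noteq> b" using assms(1) by (meson card_2_iff)
  then show ?thesis using assms(2) that[of a] that[of b] by auto
qed

text \<open>The last assumption lists how a single diamond of the graph plus xy can contain the new
  edge: as its chord, between two common neighbours, or as an outer edge, the chord then being the
  triangle edge from x or y to a common neighbour.\<close>

locale uniquely_diamond_saturated =
  fixes V :: "'a set" and E :: "'a \<Rightarrow> 'a \<Rightarrow> bool"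
  assumes finite_V: "finite V"
    and E_sym: "E x y \<Longrightarrow> E y x"
    and E_irrefl: "\<not> E x x"
    and E_in_V: "E x y \<Longrightarrow> x \<in> V"
    and diamond_free: "E a c \<Longrightarrow> E a b \<Longrightarrow> E b c \<Longrightarrow> E a d \<Longrightarrow> E c d \<Longrightarrow> b = d"
    and nonadjacent_common_neighbors:
      "x \<in> V \<Longrightarrow> y \<in> V \<Longrightarrow> x \<noteq> y \<Longrightarrow> \<not> E x y \<Longrightarrow>
        card (common_neighbors E x y) = 2 \<and>
          (\<forall>w \<in> common_neighbors E x y. \<not> triangle_edge E x w \<and> \<not> triangle_edge E y w)
        \<or> (\<exists>w. common_neighbors E x y = {w} \<and> (triangle_edge E x w \<noteq> triangle_edge E y w))"
begin

abbreviation P :: "'a \<Rightarrow> 'a \<Rightarrow> bool" where "P \<equiv> triangle_edge E"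
abbreviation C :: "'a \<Rightarrow> 'a \<Rightarrow> 'a set" where "C \<equiv> common_neighbors E"

definition B :: "'a \<Rightarrow> 'a \<Rightarrow> bool" where
  "B x y \<longleftrightarrow> E x y \<and> \<not> P x y"

definition free_degree :: "'a \<Rightarrow> nat" where
  "free_degree x = card {y. B x y}"

definition A :: "'a set" where
  "A = {x. \<exists>y. P x y}"

lemma E_in_V2: "E x y \<Longrightarrow> y \<in> V"
  using E_sym E_in_V by blast

lemma P_E: "P x y \<Longrightarrow> E x y"
  by (simp add: triangle_edge_def)

lemma B_E: "B x y \<Longrightarrow> E x y"
  by (simp add: B_def)

lemma P_sym: "P x y \<Longrightarrow> P y x"
  using E_sym unfolding triangle_edge_def by blast

lemma B_sym: "B x y \<Longrightarrow> B y x"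
  using E_sym P_sym unfolding B_def by blast

lemma E_cases: "E x y \<Longrightarrow> B x y \<or> P x y"
  by (simp add: B_def)

lemma B_not_P: "B x y \<Longrightarrow> \<not> P x y"
  by (simp add: B_def)

lemma P_I: "E x y \<Longrightarrow> E x z \<Longrightarrow> E y z \<Longrightarrow> P x y"
  unfolding triangle_edge_def by blast

lemma C_iff: "w \<in> C x y \<longleftrightarrow> E x w \<and> E y w"
  by (simp add: common_neighbors_def)

lemma finite_E: "finite {y. E x y}"
  by (rule finite_subset[OF _ finite_V]) (auto intro: E_in_V2)

lemma finite_B: "finite {y. B x y}"
  by (rule finite_subset[OF _ finite_E]) (auto intro: B_E)

lemma A_subset_V: "A \<subseteq> V"
  unfolding A_def using P_E E_in_V by blast

lemma P_in_A: "P x y \<Longrightarrow> x \<in> A \<and> y \<in> A"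
  unfolding A_def using P_sym by blast

lemma outside_A_B: "E x y \<Longrightarrow> x \<notin> A \<Longrightarrow> B x y"
  using P_in_A E_cases by blast

section \<open>Local structure of free and triangle edges\<close>

lemma nonadjacent_cases:
  assumes "x \<in> V" "y \<in> V" "x \<noteq> y" "\<not> E x y"
  obtains (two) "card (C x y) = 2" "\<And>w. w \<in> C x y \<Longrightarrow> B x w \<and> B y w"
    | (left) w where "C x y = {w}" "P x w" "B y w"
    | (right) w where "C x y = {w}" "B x w" "P y w"
proof -
  from nonadjacent_common_neighbors[OF assms] show ?thesis
  proof (elim disjE exE conjE)
    assume "card (C x y) = 2" "\<forall>w \<in> C x y. \<not> P x w \<and> \<not> P y w"
    then show ?thesis using two unfolding B_def by (simp add: C_iff)
  next
    fix w assume w: "C x y = {w}" "P x w \<noteq> P y w"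
    then have "E x w" "E y w" using C_iff[of w x y] by auto
    then show ?thesis using w left right unfolding B_def by blast
  qed
qed

text \<open>The common neighbour \<open>x\<close> sends free edges to both vertices, while the only
  common neighbour in the other cases has one triangle edge; so the two-neighbour case
  holds.\<close>

lemma B_B_common:
  assumes "B x y" "B x z" "y \<noteq> z"
  shows "\<not> E y z" "card (C y z) = 2" "\<And>w. w \<in> C y z \<Longrightarrow> B y w \<and> B z w"
proof -
  show nE: "\<not> E y z" using assms P_I B_E B_not_P by blast
  have x: "x \<in> C y z" using assms B_E E_sym by (simp add: C_iff)
  have V: "y \<in> V" "z \<in> V" using assms B_E E_in_V2 by blast+
  have "card (C y z) = 2 \<and> (\<forall>w. w \<in> C y z \<longrightarrow> B y w \<and> B z w)"
    using V assms(3) nE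
  proof (cases rule: nonadjacent_cases)
    case two then show ?thesis by blast
  next
    case (left w)
    then have "w = x" using x by simp
    then show ?thesis using left assms B_sym B_not_P by blast
  next
    case (right w)
    then have "w = x" using x by simp
    then show ?thesis using right assms B_sym B_not_P by blast
  qed
  then show "card (C y z) = 2" "\<And>w. w \<in> C y z \<Longrightarrow> B y w \<and> B z w" by auto
qed

text \<open>If \<open>y\<close> and \<open>z\<close> were nonadjacent, \<open>x\<close> would be a
  common neighbour with two triangle edges, which no case allows.\<close>

lemma P_trans:
  assumes "P x y" "P x z" "y \<noteq> z"
  shows "P y z"
proof -
  have x: "x \<in> C y z" using assms P_E E_sym by (simp add: C_iff)
  have V: "y \<in> V" "z \<in> V" using assms P_E E_in_V2 by blast+
  have "E y z"
  proof (rule ccontr)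
    assume "\<not> E y z"
    with V assms(3) show False
    proof (cases rule: nonadjacent_cases)
      case two then show ?thesis using x assms P_sym B_not_P by blast
    next
      case (left w)
      then have "w = x" using x by simp
      then show ?thesis using left assms P_sym B_not_P by blast
    next
      case (right w)
      then have "w = x" using x by simp
      then show ?thesis using right assms P_sym B_not_P by blast
    qed
  qed
  then show ?thesis using assms P_E E_sym P_I by blast
qed

text \<open>By \<open>P_trans\<close> a further triangle neighbour of \<open>x\<close> would be
  adjacent to \<open>y\<close> too, giving the edge xy two common neighbours, that is, a diamond.
  Hence triangles are vertex-disjoint.\<close>

lemma P_neighbors:
  assumes "P x y"
  obtains z where "{w. P x w} = {y, z}" "y \<noteq> z" "P x z" "P y z"
proof -
  obtain z where z: "E x y" "E x z" "E y z" using assms unfolding triangle_edge_def by blast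
  have yz: "y \<noteq> z" using z E_irrefl by blast
  have P: "P x z" "P y z" using z E_sym P_I by blast+
  have "w = z" if "P x w" "w \<noteq> y" for w
    using diamond_free[OF z(1,2) E_sym[OF z(3)] P_E[OF that(1)]] P_trans[OF assms that(1)] that P_E
    by blast
  then have "{w. P x w} = {y, z}" using assms P by blast
  then show ?thesis using that yz P by blast
qed

lemma card_P_neighbors:
  assumes "x \<in> A"
  shows "card {w. P x w} = 2"
proof -
  obtain y where "P x y" using assms unfolding A_def by blast
  then obtain z where "{w. P x w} = {y, z}" "y \<noteq> z" by (rule P_neighbors)
  then show ?thesis by simp
qed

text \<open>A common neighbour with one free and one triangle edge rules out the two-neighbour
  case.\<close>

lemma B_P_common:
  assumes "B x y" "P y z"
  shows "\<not> E x z" "x \<noteq> z" "C x z = {y}"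
proof -
  show nE: "\<not> E x z" using assms P_I B_E B_not_P P_E by blast
  show ne: "x \<noteq> z" using assms B_not_P P_sym by blast
  have y: "y \<in> C x z" using assms B_E P_E E_sym by (simp add: C_iff)
  have V: "x \<in> V" "z \<in> V" using assms B_E P_E E_in_V E_in_V2 by blast+
  show "C x z = {y}" using V ne nE
  proof (cases rule: nonadjacent_cases)
    case two then show ?thesis using y assms P_sym B_not_P by blast
  next
    case (left w) then show ?thesis using y by auto
  next
    case (right w) then show ?thesis using y by auto
  qed
qed

section \<open>Free degrees\<close>

text \<open>Sending a free neighbour \<open>w\<close> of \<open>x\<close> to the fourth vertex of the unique 4-cycle through
  \<open>w, x, y\<close> embeds the remaining free neighbours of \<open>x\<close> into those of \<open>y\<close>.\<close>

lemma B_free_degree_le: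
  assumes "B x y"
  shows "free_degree x \<le> free_degree y"
proof -
  have "\<exists>w'. B y w' \<and> B w w' \<and> w' \<noteq> x" if "B x w" "w \<noteq> y" for w
  proof -
    note c = B_B_common[OF assms that(1) that(2)[symmetric]]
    have "x \<in> C y w" using assms that B_E E_sym by (simp add: C_iff)
    then obtain w' where "C y w = {x, w'}" "w' \<noteq> x" using card_two_other[OF c(2)] by metis
    then show ?thesis using c(3)[of w'] by auto
  qed
  then obtain f where f: "\<And>w. B x w \<Longrightarrow> w \<noteq> y \<Longrightarrow> B y (f w) \<and> B w (f w) \<and> f w \<noteq> x"
    by metis
  have inj: "inj_on f ({w. B x w} - {y})"
  proof (rule inj_onI, rule ccontr)
    fix v w assume v: "v \<in> {w. B x w} - {y}" and w: "w \<in> {w. B x w} - {y}"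
      and eq: "f v = f w" and ne: "v \<noteq> w"
    have fv: "B y (f v)" "B v (f v)" "f v \<noteq> x" and fw: "B w (f v)"
      using f v w eq by (auto, metis)
    \<comment> \<open>\<open>x\<close> and \<open>f v\<close> are both free neighbours of
      \<open>y\<close>, so they have only two common neighbours; a collision of \<open>f\<close>
      would give the three \<open>y\<close>, \<open>v\<close>, \<open>w\<close>.\<close>
    have c: "card (C x (f v)) = 2"
      using B_B_common(2)[OF B_sym[OF assms] fv(1)] fv(3) by blast
    have "{y, v, w} \<subseteq> C x (f v)"
      using assms v w fv fw B_E B_sym by (auto simp: C_iff)
    moreover have "finite (C x (f v))" using c card.infinite by fastforce
    ultimately have "card {y, v, w} \<le> 2" using c card_mono by metis
    then show False using ne v w by auto
  qed
  have "card ({w. B x w} - {y}) \<le> card ({w. B y w} - {x})"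
    by (rule card_inj_on_le[OF inj]) (use f finite_B in auto)
  moreover have "card {w. B x w} > 0" using assms finite_B card_gt_0_iff by fastforce
  moreover have "card {w. B y w} > 0" using assms finite_B card_gt_0_iff B_sym by fastforce
  ultimately show ?thesis
    unfolding free_degree_def using assms B_sym finite_B by (simp add: card_Diff_singleton)
qed

lemma B_free_degree_eq: "B x y \<Longrightarrow> free_degree x = free_degree y"
  using B_free_degree_le B_sym by (meson le_antisym)

lemma free_degree_pos: "B x y \<Longrightarrow> 0 < free_degree x"
  unfolding free_degree_def using finite_B card_gt_0_iff by fastforce

text \<open>Double counting between the free neighbours of \<open>x\<close> other than \<open>y\<close> and those of \<open>z\<close>, where
  a free edge has weight 1 and a triangle edge weight 2: both cases of the dichotomy for a
  nonadjacent pair then contribute weight 2.\<close>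

lemma free_degree_triangle_mate:
  assumes xy: "B x y" and yz: "P y z"
  shows "free_degree x + card {w. B z w \<and> (\<exists>m. P x m \<and> B w m)} = free_degree z + 1"
proof -
  define X where "X = {w. B x w} - {y}"
  define Y where "Y = {w. B z w}"
  define Z where "Z = {w. B z w \<and> (\<exists>m. P x m \<and> B w m)}"
  define wt :: "'a \<Rightarrow> 'a \<Rightarrow> nat" where
    "wt v w = (if B v w then 1 else if P v w then 2 else 0)" for v w
  have fX: "finite X" and fY: "finite Y" unfolding X_def Y_def using finite_B by auto
  have ZY: "Z \<subseteq> Y" unfolding Z_def Y_def by blast
  note xz = B_P_common[OF xy yz]
  have wt_0: "wt v w = 0" if "\<not> E v w" for v w
    unfolding wt_def using that B_E P_E by auto
  have sumX: "(\<Sum>w\<in>Y. wt v w) = 2" if "v \<in> X" for v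
  proof -
    have v: "B x v" "v \<noteq> y" using that unfolding X_def by auto
    have "v \<in> V" "z \<in> V" using v yz B_E P_E E_in_V2 by blast+
    have "v \<noteq> z" using v xz B_E by blast
    have nvz: "\<not> E v z"
    proof
      assume "E v z"
      then have "v \<in> C x z" using v B_E E_sym by (simp add: C_iff)
      then show False using xz v by auto
    qed
    have YC: "wt v w = 0" if "w \<in> Y - C v z" for w
      using that wt_0 B_E unfolding Y_def by (auto simp: C_iff)
    from \<open>v \<in> V\<close> \<open>z \<in> V\<close> \<open>v \<noteq> z\<close> nvz show ?thesis
    proof (cases rule: nonadjacent_cases)
      case two
      have "(\<Sum>w\<in>Y. wt v w) = (\<Sum>w\<in>C v z. 1)"
      proof (rule sum.mono_neutral_cong_right[OF fY])
        show "C v z \<subseteq> Y" using two(2) unfolding Y_def by blast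
        show "\<forall>w \<in> Y - C v z. wt v w = 0"
          using YC by blast
      qed (use two(2) in \<open>simp add: wt_def\<close>)
      then show ?thesis using two by simp
    next
      case (left w)
      have "(\<Sum>w\<in>Y. wt v w) = (\<Sum>w\<in>{w}. 2)"
      proof (rule sum.mono_neutral_cong_right[OF fY])
        show "{w} \<subseteq> Y" using left unfolding Y_def by blast
        have "\<forall>u \<in> Y - C v z. wt v u = 0"
          using YC by blast
        then show "\<forall>u \<in> Y - {w}. wt v u = 0" using left by simp
      qed (use left B_not_P in \<open>auto simp: wt_def\<close>)
      then show ?thesis by simp
    next
      \<comment> \<open>Impossible: \<open>w = y\<close> would put the free edge xy in the triangle
        xyv; otherwise \<open>w\<close> is the third vertex of the triangle on \<open>y\<close>,
        \<open>z\<close>, and \<open>x\<close>, \<open>w\<close> would have the second common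
        neighbour \<open>v\<close>.\<close>
      case (right w)
      show ?thesis
      proof (cases "w = y")
        case True
        then have "P x y" using right v xy B_E E_sym P_I by blast
        then show ?thesis using xy B_not_P by blast
      next
        case False
        then have "P y w" using P_trans[OF P_sym[OF yz]] right by blast
        from B_P_common(3)[OF xy this] have "v \<notin> C x w" using v by simp
        moreover have "v \<in> C x w" using v right B_E E_sym by (simp add: C_iff)
        ultimately show ?thesis by blast
      qed
    qed
  qed
  \<comment> \<open>\<open>Z\<close> collects the defects: there the only common neighbour of
    \<open>x\<close> and \<open>w\<close> is a triangle mate of \<open>x\<close>, hence not in
    \<open>X\<close>.\<close>
  have sumY: "(\<Sum>v\<in>X. wt v w) = (if w \<in> Z then 0 else 2)" if "w \<in> Y" for w
  proof -
    have w: "B z w" using that unfolding Y_def by auto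
    have nyw: "\<not> E y w"
      using w yz P_E B_E P_I B_not_P E_sym by blast
    have XC: "wt v w = 0" if "v \<in> X - C x w" for v
    proof -
      have "\<not> E v w" using that B_E E_sym[of v w] unfolding X_def by (auto simp: C_iff)
      then show ?thesis by (rule wt_0)
    qed
    have "x \<in> V" "w \<in> V" using xy w B_E E_in_V2 E_in_V by blast+
    moreover have "x \<noteq> w" using w xz B_E E_sym by blast
    moreover have nxw: "\<not> E x w"
    proof
      assume "E x w"
      then have "w \<in> C x z" using w B_E by (simp add: C_iff)
      then have "w = y" using xz by auto
      then show False using w yz P_sym B_not_P by blast
    qed
    ultimately show ?thesis
    proof (cases rule: nonadjacent_cases)
      case two
      have "w \<notin> Z"
      proof
        assume "w \<in> Z"
        then obtain m where m: "P x m" "B w m" unfolding Z_def by blast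
        then have "m \<in> C x w" using P_E B_E by (simp add: C_iff)
        then show False using two m B_not_P by blast
      qed
      moreover have "(\<Sum>v\<in>X. wt v w) = (\<Sum>v\<in>C x w. 1)"
      proof (rule sum.mono_neutral_cong_right[OF fX])
        show "C x w \<subseteq> X" using two(2) nyw B_E E_sym unfolding X_def by blast
        show "\<forall>v \<in> X - C x w. wt v w = 0" using XC by blast
      qed (use two(2) B_sym in \<open>auto simp: wt_def\<close>)
      ultimately show ?thesis using two by simp
    next
      case (left m)
      then have "w \<in> Z" using w unfolding Z_def by blast
      moreover have "wt v w = 0" if "v \<in> X" for v
      proof (cases "v = m")
        case True then show ?thesis using that left B_not_P unfolding X_def by blast
      next
        case False then show ?thesis using XC left that by blast
      qed
      ultimately show ?thesis by simp
    next
      case (right m)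
      have "w \<notin> Z"
      proof
        assume "w \<in> Z"
        then obtain l where l: "P x l" "B w l" unfolding Z_def by blast
        then have "l \<in> C x w" using P_E B_E by (simp add: C_iff)
        then show False using right l B_not_P by auto
      qed
      moreover have "(\<Sum>v\<in>X. wt v w) = (\<Sum>v\<in>{m}. 2)"
      proof (rule sum.mono_neutral_cong_right[OF fX])
        show "{m} \<subseteq> X" using right nyw P_E E_sym unfolding X_def by blast
        show "\<forall>v \<in> X - {m}. wt v w = 0" using XC right by blast
      qed (use right B_not_P P_sym B_sym in \<open>auto simp: wt_def\<close>)
      ultimately show ?thesis by simp
    qed
  qed
  have "2 * card X = (\<Sum>v\<in>X. \<Sum>w\<in>Y. wt v w)" using sumX by simp
  also have "\<dots> = (\<Sum>w\<in>Y. \<Sum>v\<in>X. wt v w)" by (rule sum.swap)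
  also have "\<dots> = (\<Sum>w\<in>Y. if w \<in> Z then 0 else 2)" using sumY by simp
  also have "\<dots> = (\<Sum>w\<in>Y - Z. 2)"
    by (rule sum.mono_neutral_cong_right[OF fY]) auto
  also have "\<dots> = 2 * (card Y - card Z)"
    using ZY fY by (simp add: card_Diff_subset finite_subset)
  finally have "card X = card Y - card Z" by simp
  moreover have "card Z \<le> card Y" using ZY fY card_mono by blast
  moreover have "card X = free_degree x - 1"
    unfolding X_def free_degree_def using xy finite_B by (simp add: card_Diff_singleton)
  moreover have "free_degree x > 0" using free_degree_pos xy by blast
  ultimately show ?thesis unfolding Y_def free_degree_def[of z] Z_def by linarith
qed

section \<open>Vertices outside all triangles\<close>

text \<open>By \<open>B_P_common\<close> the free edge pq is the only edge between the two
  triangles. A sole common neighbour of the mates would lie in one triangle and give a second such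
  edge.\<close>

lemma mates_common:
  assumes pq: "B p q" and p: "P p p'" and q: "P q q'"
  shows "card (C p' q') = 2" "\<And>w. w \<in> C p' q' \<Longrightarrow> B p' w \<and> B q' w"
proof -
  have npq: "\<not> E p' v" if "P q v" for v
  proof
    assume "E p' v"
    then have "p' \<in> C p v" using p P_E E_sym by (simp add: C_iff)
    then have "p' = q" using B_P_common(3)[OF pq that] by simp
    then show False using p pq B_not_P by blast
  qed
  have nqp: "\<not> E q' v" if "P p v" for v
  proof
    assume "E q' v"
    then have "q' \<in> C q v" using q P_E E_sym by (simp add: C_iff)
    then have "q' = p" using B_P_common(3)[OF B_sym[OF pq] that] by simp
    then show False using q pq B_not_P B_sym by blast
  qed
  have V: "p' \<in> V" "q' \<in> V" using p q P_E E_in_V2 by blast+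
  have ne: "p' \<noteq> q'" using B_P_common(1)[OF pq q] p P_E by blast
  have "card (C p' q') = 2 \<and> (\<forall>w. w \<in> C p' q' \<longrightarrow> B p' w \<and> B q' w)"
    using V ne npq[OF q]
  proof (cases rule: nonadjacent_cases)
    case two then show ?thesis by blast
  next
    case (left w)
    show ?thesis
    proof (cases "w = p")
      case True
      then show ?thesis using left B_P_common(1)[OF pq q] B_E E_sym by blast
    next
      case False
      then have "P p w" using P_trans[OF P_sym[OF p] left(2)] by blast
      then show ?thesis using nqp left B_E by blast
    qed
  next
    case (right w)
    show ?thesis
    proof (cases "w = q")
      case True
      then show ?thesis using right B_P_common(1)[OF B_sym[OF pq] p] B_E E_sym by blast
    next
      case False
      then have "P q w" using P_trans[OF P_sym[OF q] right(3)] by blast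
      then show ?thesis using npq right B_E by blast
    qed
  qed
  then show "card (C p' q') = 2" "\<And>w. w \<in> C p' q' \<Longrightarrow> B p' w \<and> B q' w" by auto
qed

text \<open>The defect set in \<open>free_degree_triangle_mate\<close> contains both common
  neighbours of the mates \<open>p'\<close> and \<open>q'\<close>, so it has at least 2
  elements.\<close>

lemma free_degree_mate_less:
  assumes "B p q" "P q q'" "p \<in> A"
  shows "free_degree p < free_degree q'"
proof -
  obtain p' where p': "P p p'" using assms unfolding A_def by blast
  note c = mates_common[OF assms(1) p' assms(2)]
  let ?Z = "{w. B q' w \<and> (\<exists>m. P p m \<and> B w m)}"
  have "C p' q' \<subseteq> ?Z" using c(2) p' B_sym by blast
  moreover have "finite ?Z" using finite_B by (rule rev_finite_subset) blast
  ultimately have "2 \<le> card ?Z" using c(1) card_mono by metis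
  then show ?thesis using free_degree_triangle_mate[OF assms(1,2)] by linarith
qed

text \<open>If all vertices were in \<open>A\<close>, strict comparison along pq and along a free
  edge from \<open>p'\<close> to \<open>w\<close>, with constancy on free edges, would give the free
  degrees of \<open>p\<close> and \<open>p'\<close> strict inequalities in both directions.\<close>

lemma B_imp_outside_A:
  assumes "B p q"
  shows "\<exists>u \<in> V. u \<notin> A"
proof (rule ccontr)
  assume "\<not> ?thesis"
  then have all: "u \<in> A" if "u \<in> V" for u using that by blast
  have pqA: "p \<in> A" "q \<in> A" using all assms B_E E_in_V E_in_V2 by blast+
  then obtain p' q' where p': "P p p'" and q': "P q q'" unfolding A_def by blast
  have "C p' q' \<noteq> {}" using mates_common(1)[OF assms p' q'] by auto
  then obtain w where w: "B p' w" using mates_common(2)[OF assms p' q'] by blast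
  have "w \<in> A" using w all B_E E_in_V2 by blast
  then have "free_degree w < free_degree p" using free_degree_mate_less[OF B_sym[OF w] P_sym[OF p']] by blast
  moreover have "free_degree q < free_degree p'" using free_degree_mate_less[OF B_sym[OF assms] p'] pqA by blast
  ultimately show False using B_free_degree_eq[OF w] B_free_degree_eq[OF assms] by simp
qed

text \<open>Every case for a nonadjacent pair supplies a free edge, and an adjacent pair in no
  common triangle is one.\<close>

lemma exists_outside_A:
  assumes "x \<in> A" "y \<in> A" "x \<noteq> y" "\<not> P x y"
  shows "\<exists>u \<in> V. u \<notin> A"
proof (cases "E x y")
  case True
  then show ?thesis using assms E_cases B_imp_outside_A by blast
next
  case False
  have "\<exists>p q. B p q"
  proof -
    have "x \<in> V" "y \<in> V" using assms A_subset_V by auto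
    then show ?thesis using assms(3) False
    proof (cases rule: nonadjacent_cases)
      case two
      then have "C x y \<noteq> {}" by auto
      then show ?thesis using two by blast
    qed blast+
  qed
  then show ?thesis using B_imp_outside_A by blast
qed

text \<open>Nonadjacent vertices are at distance two, so a path of length at most two from
  \<open>A\<close> to an outside vertex leaves \<open>A\<close>. This makes the set under the
  minimum nonempty.\<close>

lemma exists_boundary_vertex:
  assumes "x \<in> A" "y \<in> A" "x \<noteq> y" "\<not> P x y"
  shows "\<exists>u \<in> V. u \<notin> A \<and> (\<exists>a\<in>A. E a u)"
proof -
  obtain u where u: "u \<in> V" "u \<notin> A" using exists_outside_A[OF assms] by blast
  have x: "x \<in> V" "x \<noteq> u" using assms u A_subset_V by auto
  show ?thesis
  proof (cases "E x u")
    case True then show ?thesis using u assms by blast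
  next
    case False
    have "\<exists>w. E x w \<and> E w u"
      using x(1) u(1) x(2) False
    proof (cases rule: nonadjacent_cases)
      case two
      then have "C x u \<noteq> {}" by auto
      then show ?thesis using E_sym by (auto simp: common_neighbors_def)
    next
      case (left w) then show ?thesis using P_E B_E E_sym by blast
    next
      case (right w) then show ?thesis using P_E B_E E_sym by blast
    qed
    then obtain w where "E x w" "E w u" by blast
    then show ?thesis using u assms E_in_V2 by (cases "w \<in> A") blast+
  qed
qed

section \<open>Counting around a vertex outside \<open>A\<close>\<close>

text \<open>Since \<open>u\<close> has no triangle mates, its free degree exceeds that of
  \<open>y\<close>, a mate of \<open>x\<close>, by exactly one. If \<open>v\<close> had no neighbour
  in \<open>A\<close>, it would be joined to \<open>y\<close> by a path of two free edges, and the
  free degrees of \<open>u\<close>, \<open>v\<close>, \<open>y\<close> would agree.\<close>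

lemma outside_neighbor_has_A_neighbor:
  assumes u: "u \<notin> A" and x: "x \<in> A" "E u x" and v: "v \<notin> A" "E u v"
  shows "\<exists>a \<in> A. E v a"
proof (rule ccontr)
  assume none: "\<not> ?thesis"
  obtain y where y: "P x y" using x unfolding A_def by blast
  have Bux: "B u x" and Buv: "B u v" using outside_A_B u x v by blast+
  have nP: "\<not> P u m" for m using u unfolding A_def by blast
  have "free_degree u = free_degree y + 1" using free_degree_triangle_mate[OF Bux y] nP by simp
  moreover have "free_degree v = free_degree y"
  proof -
    have yA: "y \<in> A" using y P_in_A by blast
    then have "v \<in> V" "y \<in> V" "v \<noteq> y" "\<not> E v y"
      using v E_in_V2 A_subset_V none by blast+
    then show ?thesis
    proof (cases rule: nonadjacent_cases)
      case two
      then have "C v y \<noteq> {}" by auto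
      then obtain w where "B v w" "B y w" using two(2) by blast
      then show ?thesis using B_free_degree_eq by metis
    next
      case (left w) then show ?thesis using v P_in_A by blast
    next
      case (right w) then show ?thesis using none P_in_A B_E by blast
    qed
  qed
  ultimately show False using B_free_degree_eq[OF Buv] by simp
qed

text \<open>Two neighbours of \<open>u\<close> in one triangle would put \<open>u\<close> itself in
  a triangle, so each neighbour in \<open>A\<close> hits its own triangle.\<close>

lemma card_hit_triangles:
  assumes u: "u \<notin> A"
  shows "card (\<Union>w\<in>{w. E u w} \<inter> A. insert w {z. P w z}) = 3 * card ({w. E u w} \<inter> A)"
proof -
  let ?N = "{w. E u w} \<inter> A"
  have fP: "finite {z. P w z}" for w
    by (rule finite_subset[OF _ finite_E]) (auto intro: P_E)
  have "card (\<Union>w\<in>?N. insert w {z. P w z}) = (\<Sum>w\<in>?N. card (insert w {z. P w z}))"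
  proof (rule card_UN_disjoint)
    show "finite ?N" using finite_E by blast
    show "\<forall>w\<in>?N. finite (insert w {z. P w z})" using fP by blast
    show "\<forall>v\<in>?N. \<forall>w\<in>?N. v \<noteq> w \<longrightarrow> insert v {z. P v z} \<inter> insert w {z. P w z} = {}"
    proof (intro ballI impI, rule ccontr)
      fix v w assume v: "v \<in> ?N" and w: "w \<in> ?N" and ne: "v \<noteq> w"
        and "insert v {z. P v z} \<inter> insert w {z. P w z} \<noteq> {}"
      then have "P v w" using P_trans P_sym by blast
      then have "P u v" using v w P_E P_I by blast
      then show False using u P_in_A by blast
    qed
  qed
  also have "\<dots> = (\<Sum>w\<in>?N. 3)"
  proof (rule sum.cong)
    fix w assume "w \<in> ?N"
    then have "card {z. P w z} = 2" using card_P_neighbors by blast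
    moreover have "w \<notin> {z. P w z}" using P_E E_irrefl by blast
    ultimately show "card (insert w {z. P w z}) = 3" using fP by simp
  qed simp
  finally show ?thesis by simp
qed

lemma hit_triangles_subset: "(\<Union>w\<in>{w. E u w} \<inter> A. insert w {z. P w z}) \<subseteq> A"
  using P_in_A by blast

lemma finite_A: "finite A"
  using A_subset_V finite_V finite_subset by blast

text \<open>The number of triangles enters the locale only as a \<open>k\<close> with
  \<open>card A \<le> 3 * k\<close>.\<close>

lemma card_A_neighbors_le:
  assumes "u \<notin> A" "card A \<le> 3 * k"
  shows "card ({w. E u w} \<inter> A) \<le> k"
  using card_mono[OF finite_A hit_triangles_subset[of u]] card_hit_triangles[OF assms(1)] assms(2)
  by simp

text \<open>A neighbour of \<open>u\<close> outside \<open>A\<close> is adjacent to a triangle which contains no neighbour of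
  \<open>u\<close>, and every vertex of such a triangle has exactly two common neighbours with \<open>u\<close>.\<close>

lemma card_outside_neighbors_le:
  assumes u: "u \<notin> A" and x: "x \<in> A" "E u x" and A: "card A \<le> 3 * k"
  shows "card ({w. E u w} - A) \<le> 6 * (k - card ({w. E u w} \<inter> A))"
proof -
  let ?N = "{w. E u w} \<inter> A"
  let ?H = "\<Union>w\<in>?N. insert w {z. P w z}"
  have M: "card (C u y) = 2" if y: "y \<in> A - ?H" for y
  proof -
    have n: "\<not> E u y" "\<not> E u z" if "P y z" for z
      using y P_sym[OF that] P_in_A[OF that] by blast+
    have "u \<in> V" "y \<in> V" "u \<noteq> y" using u x y A_subset_V E_in_V by blast+
    moreover have "\<not> E u y" using y by blast
    ultimately show ?thesis
    proof (cases rule: nonadjacent_cases)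
      case two then show ?thesis by blast
    next
      case (left w) then show ?thesis using u P_in_A by blast
    next
      case (right w) then show ?thesis using n B_E by blast
    qed
  qed
  have sub: "{w. E u w} - A \<subseteq> (\<Union>y\<in>A - ?H. C u y)"
  proof
    fix v assume v: "v \<in> {w. E u w} - A"
    then obtain y where y: "y \<in> A" "E v y"
      using outside_neighbor_has_A_neighbor[OF u x] by blast
    have "\<not> E u y"
    proof
      assume "E u y"
      then have "P u v" using v y P_I by blast
      then show False using u P_in_A by blast
    qed
    \<comment> \<open>A mate of \<open>y\<close> adjacent to \<open>u\<close> would be the only
      common neighbour of \<open>u\<close> and \<open>y\<close>, hence equal to \<open>v\<close>,
      which is outside \<open>A\<close>.\<close>
    moreover have "\<not> E u z" if "P z y" for z
    proof
      assume z: "E u z"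
      have "C u y = {z}" using B_P_common(3)[OF outside_A_B[OF z u] that] .
      moreover have "v \<in> C u y" using v y E_sym by (simp add: C_iff)
      ultimately show False using v P_in_A[OF that] by simp
    qed
    ultimately have "y \<notin> ?H" by blast
    then show "v \<in> (\<Union>y\<in>A - ?H. C u y)" using v y E_sym by (auto simp: C_iff)
  qed
  have fin: "finite (A - ?H)" using finite_A by blast
  have finC: "finite (C u y)" for y
    by (rule finite_subset[OF _ finite_E[of u]]) (auto simp: common_neighbors_def)
  have "card ({w. E u w} - A) \<le> card (\<Union>y\<in>A - ?H. C u y)"
    by (rule card_mono[OF _ sub]) (use fin finC in blast)
  also have "\<dots> \<le> (\<Sum>y\<in>A - ?H. card (C u y))" by (rule card_UN_le[OF fin])
  also have "\<dots> = (\<Sum>y\<in>A - ?H. 2)" by (rule sum.cong) (use M in auto)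
  also have "\<dots> = 2 * (card A - 3 * card ?N)"
    using card_Diff_subset[OF finite_subset[OF hit_triangles_subset finite_A] hit_triangles_subset]
      card_hit_triangles[OF u] by simp
  also have "\<dots> \<le> 6 * (k - card ?N)" using A by simp
  finally show ?thesis .
qed

lemma card_V_le:
  assumes u: "u \<in> V" "u \<notin> A"
  defines "D \<equiv> card {w. E u w}"
  shows "card V \<le> 1 + D + (D choose 2) + 2 * card ({w. E u w} \<inter> A)"
proof -
  let ?N = "{w. E u w}"
  let ?Q = "{v \<in> V. v \<noteq> u \<and> \<not> E u v \<and> card (C u v) = 2}"
  let ?R = "\<Union>w\<in>?N \<inter> A. {z. P w z}"
  have fP: "finite {z. P w z}" for w
    by (rule finite_subset[OF _ finite_E]) (auto intro: P_E)
  have "V \<subseteq> {u} \<union> ?N \<union> ?Q \<union> ?R"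
  proof
    fix v assume v: "v \<in> V"
    show "v \<in> {u} \<union> ?N \<union> ?Q \<union> ?R"
    proof (cases "v = u \<or> E u v")
      case False
      then have "u \<noteq> v" "\<not> E u v" by auto
      with u(1) v show ?thesis
      proof (cases rule: nonadjacent_cases)
        case two then show ?thesis using v False by blast
      next
        case (left w) then show ?thesis using u P_in_A by blast
      next
        case (right w)
        then have "w \<in> ?N \<inter> A" "P w v" using B_E P_in_A P_sym by blast+
        then show ?thesis by blast
      qed
    qed auto
  qed
  moreover have "finite ({u} \<union> ?N \<union> ?Q \<union> ?R)" using finite_E finite_V fP by simp
  ultimately have "card V \<le> card ({u} \<union> ?N \<union> ?Q \<union> ?R)" by (rule card_mono[rotated])
  also have "\<dots> \<le> card {u} + card ?N + card ?Q + card ?R"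
    by (meson add_le_mono card_Un_le le_refl order_trans)
  finally have V: "card V \<le> 1 + D + card ?Q + card ?R" unfolding D_def by simp
  have "card ?R \<le> (\<Sum>w\<in>?N \<inter> A. card {z. P w z})"
    by (rule card_UN_le) (use finite_A in blast)
  also have "\<dots> = (\<Sum>w\<in>?N \<inter> A. 2)" by (rule sum.cong) (use card_P_neighbors in auto)
  finally have R: "card ?R \<le> 2 * card (?N \<inter> A)" by simp
  \<comment> \<open>The pair \<open>p\<close>, \<open>q\<close> recovers \<open>v\<close>: both are
    free neighbours of \<open>u\<close>, so they have just one further common neighbour.\<close>
  have "inj_on (C u) ?Q"
  proof (rule inj_onI, rule ccontr)
    fix v w assume v: "v \<in> ?Q" and w: "w \<in> ?Q" and eq: "C u v = C u w" and ne: "v \<noteq> w"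
    obtain p q where pq: "C u v = {p, q}" "p \<noteq> q"
      using v by (auto simp: card_2_iff)
    then have "p \<in> C u v" "q \<in> C u v" "p \<in> C u w" "q \<in> C u w" using eq by auto
    then have e: "E u p" "E u q" "E v p" "E v q" "E w p" "E w q" by (auto simp: C_iff)
    have c: "card (C p q) = 2"
      using B_B_common(2)[OF outside_A_B[OF e(1) u(2)] outside_A_B[OF e(2) u(2)] pq(2)] .
    have "{u, v, w} \<subseteq> C p q" using e E_sym by (simp add: C_iff)
    moreover have "finite (C p q)" using c card.infinite by fastforce
    ultimately have "card {u, v, w} \<le> 2" using c card_mono by metis
    then show False using ne v w by auto
  qed
  then have "card ?Q \<le> card {S. S \<subseteq> ?N \<and> card S = 2}"
  proof (rule card_inj_on_le)
    show "C u ` ?Q \<subseteq> {S. S \<subseteq> ?N \<and> card S = 2}" by (auto simp: C_iff)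
    show "finite {S. S \<subseteq> ?N \<and> card S = 2}"
      by (rule finite_subset[of _ "Pow ?N"]) (use finite_E in auto)
  qed
  also have "\<dots> = D choose 2" unfolding D_def using n_subsets[OF finite_E] .
  finally show ?thesis using V R by simp
qed

end

section \<open>Copies of a graph as explicit vertex tuples\<close>

definition image_graph :: "('b \<Rightarrow> 'a) \<Rightarrow> 'b graph \<Rightarrow> 'a graph" where
  "image_graph g H = \<lparr>vertices = g ` vertices H, edges = (\<lambda>e. g ` e) ` edges H\<rparr>"

lemma adjacent_commute: "adjacent G u v \<longleftrightarrow> adjacent G v u"
  by (simp add: adjacent_def insert_commute)

lemma simple_graph_edgeE:
  assumes "simple_graph G" "e \<in> edges G"
  obtains u v where "e = {u, v}" "u \<in> vertices G" "v \<in> vertices G" "adjacent G u v"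
proof -
  have "card e = 2" "e \<subseteq> vertices G" using assms by (auto simp: simple_graph_def)
  moreover then obtain u v where "e = {u, v}" by (meson card_2_iff)
  ultimately show ?thesis using that assms(2) by (simp add: adjacent_def)
qed

text \<open>The map \<open>g\<close> is the inverse of the isomorphism. Both graphs being simple,
  agreement of adjacency on vertices determines the edge sets.\<close>

lemma copies_eq_image_graphs:
  assumes H: "simple_graph H"
  shows "copies H G = {image_graph g H | g. inj_on g (vertices H) \<and>
    vertices (image_graph g H) \<subseteq> vertices G \<and> edges (image_graph g H) \<subseteq> edges G}"
proof (intro equalityI subsetI)
  fix S assume "S \<in> copies H G"
  then have S: "simple_graph S" "vertices S \<subseteq> vertices G" "edges S \<subseteq> edges G"
    and "graph_isomorphic S H"
    by (auto simp: copies_def subgraph_def)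
  then obtain f where f: "bij_betw f (vertices S) (vertices H)"
    and adj: "\<And>u v. u \<in> vertices S \<Longrightarrow> v \<in> vertices S \<Longrightarrow> adjacent S u v \<longleftrightarrow> adjacent H (f u) (f v)"
    unfolding graph_isomorphic_def by blast
  define g where "g = inv_into (vertices S) f"
  have g: "bij_betw g (vertices H) (vertices S)"
    unfolding g_def using f by (rule bij_betw_inv_into)
  have gf: "g (f u) = u" if "u \<in> vertices S" for u
    unfolding g_def using f that by (rule bij_betw_inv_into_left)
  have fg: "f (g i) = i" if "i \<in> vertices H" for i
    unfolding g_def using f that by (rule bij_betw_inv_into_right)
  have "edges S = (\<lambda>e. g ` e) ` edges H"
  proof (intro equalityI subsetI)
    fix e assume "e \<in> edges S"
    with S(1) obtain u v where uv: "e = {u, v}" "u \<in> vertices S" "v \<in> vertices S" "adjacent S u v"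
      by (rule simple_graph_edgeE)
    then have "{f u, f v} \<in> edges H" using adj by (simp add: adjacent_def)
    moreover have "e = g ` {f u, f v}" using uv gf by simp
    ultimately show "e \<in> (\<lambda>e. g ` e) ` edges H" by blast
  next
    fix e assume "e \<in> (\<lambda>e. g ` e) ` edges H"
    then obtain d where d: "d \<in> edges H" "e = g ` d" by blast
    from H d(1) obtain i j where ij: "d = {i, j}" "i \<in> vertices H" "j \<in> vertices H" "adjacent H i j"
      by (rule simple_graph_edgeE)
    have "g i \<in> vertices S" "g j \<in> vertices S" using g ij by (auto simp: bij_betw_def)
    then have "adjacent S (g i) (g j)" using adj fg ij by simp
    then show "e \<in> edges S" using d ij by (simp add: adjacent_def)
  qed
  moreover have "vertices S = g ` vertices H" using g by (simp add: bij_betw_def)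
  ultimately have "S = image_graph g H" by (simp add: image_graph_def)
  moreover have "inj_on g (vertices H)" using g by (simp add: bij_betw_def)
  ultimately show "S \<in> {image_graph g H | g. inj_on g (vertices H) \<and>
      vertices (image_graph g H) \<subseteq> vertices G \<and> edges (image_graph g H) \<subseteq> edges G}"
    using S by blast
next
  fix S assume "S \<in> {image_graph g H | g. inj_on g (vertices H) \<and>
      vertices (image_graph g H) \<subseteq> vertices G \<and> edges (image_graph g H) \<subseteq> edges G}"
  then obtain g where S: "S = image_graph g H" and inj: "inj_on g (vertices H)"
    and sub: "vertices S \<subseteq> vertices G" "edges S \<subseteq> edges G" by blast
  have e: "e \<subseteq> vertices H" "card e = 2" if "e \<in> edges H" for e
    using H that by (auto simp: simple_graph_def)
  have "card (g ` e) = 2" if "e \<in> edges H" for e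
    using card_image[OF inj_on_subset[OF inj e(1)[OF that]]] e(2)[OF that] by simp
  then have simple: "simple_graph S"
    using H e unfolding S image_graph_def simple_graph_def by auto
  define f where "f = inv_into (vertices H) g"
  have bij: "bij_betw f (vertices S) (vertices H)"
    unfolding f_def S image_graph_def using inj by (simp add: bij_betw_inv_into inj_on_imp_bij_betw)
  have "adjacent S (g i) (g j) \<longleftrightarrow> adjacent H i j" if ij: "i \<in> vertices H" "j \<in> vertices H" for i j
  proof
    assume "adjacent S (g i) (g j)"
    then obtain d where d: "d \<in> edges H" "g ` {i, j} = g ` d"
      unfolding adjacent_def S image_graph_def by auto
    then have "{i, j} = d" using inj_on_image_eq_iff[OF inj] e(1) ij by (metis empty_subsetI insert_subset)
    then show "adjacent H i j" using d by (simp add: adjacent_def)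
  next
    assume "adjacent H i j"
    then have "g ` {i, j} \<in> edges S"
      unfolding adjacent_def S image_graph_def graph.simps by (rule imageI)
    then show "adjacent S (g i) (g j)" by (simp add: adjacent_def)
  qed
  then have "\<forall>u\<in>vertices S. \<forall>v\<in>vertices S. adjacent S u v \<longleftrightarrow> adjacent H (f u) (f v)"
    using inj unfolding f_def S image_graph_def by simp
  then have "graph_isomorphic S H" unfolding graph_isomorphic_def using bij by blast
  then show "S \<in> copies H G" using simple sub by (simp add: copies_def subgraph_def)
qed

definition triangle_on :: "'a \<Rightarrow> 'a \<Rightarrow> 'a \<Rightarrow> 'a graph" where
  "triangle_on a b c = \<lparr>vertices = {a, b, c}, edges = {{a, b}, {b, c}, {c, a}}\<rparr>"

definition diamond_on :: "'a \<Rightarrow> 'a \<Rightarrow> 'a \<Rightarrow> 'a \<Rightarrow> 'a graph" where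
  "diamond_on a b c d =
    \<lparr>vertices = {a, b, c, d}, edges = {{a, b}, {b, c}, {c, d}, {d, a}, {a, c}}\<rparr>"

lemma copies_triangle_iff:
  "S \<in> copies triangle G \<longleftrightarrow> (\<exists>a b c. S = triangle_on a b c \<and> distinct [a, b, c] \<and>
    {a, b, c} \<subseteq> vertices G \<and> adjacent G a b \<and> adjacent G b c \<and> adjacent G c a)"
  (is "_ \<longleftrightarrow> (\<exists>a b c. ?R a b c)")
proof -
  have simple: "simple_graph triangle" by (auto simp: simple_graph_def triangle_def)
  have im: "image_graph g triangle = triangle_on (g 0) (g 1) (g 2)" for g :: "nat \<Rightarrow> 'a"
    by (simp add: image_graph_def triangle_def triangle_on_def)
  have inj: "inj_on g (vertices triangle) \<longleftrightarrow> distinct [g 0, g 1, g 2]" for g :: "nat \<Rightarrow> 'a"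
    by (auto simp: triangle_def)
  have "S \<in> copies triangle G \<longleftrightarrow> (\<exists>g :: nat \<Rightarrow> 'a. ?R (g 0) (g 1) (g 2))"
    unfolding copies_eq_image_graphs[OF simple] im inj
    by (auto simp: triangle_on_def adjacent_def)
  also have "\<dots> \<longleftrightarrow> (\<exists>a b c. ?R a b c)"
  proof
    assume "\<exists>a b c. ?R a b c"
    then obtain a b c where abc: "?R a b c" by blast
    let ?g = "\<lambda>i :: nat. if i = 0 then a else if i = 1 then b else c"
    have "?R (?g 0) (?g 1) (?g 2)" using abc by simp
    then show "\<exists>g :: nat \<Rightarrow> 'a. ?R (g 0) (g 1) (g 2)" by (rule exI[of _ ?g])
  qed blast
  finally show ?thesis .
qed

lemma copies_diamond_iff:
  "S \<in> copies diamond G \<longleftrightarrow> (\<exists>a b c d. S = diamond_on a b c d \<and> distinct [a, b, c, d] \<and>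
    {a, b, c, d} \<subseteq> vertices G \<and> adjacent G a b \<and> adjacent G b c \<and> adjacent G c d \<and>
    adjacent G d a \<and> adjacent G a c)"
  (is "_ \<longleftrightarrow> (\<exists>a b c d. ?R a b c d)")
proof -
  have simple: "simple_graph diamond" by (auto simp: simple_graph_def diamond_def)
  have im: "image_graph g diamond = diamond_on (g 0) (g 1) (g 2) (g 3)" for g :: "nat \<Rightarrow> 'a"
    by (simp add: image_graph_def diamond_def diamond_on_def)
  have inj: "inj_on g (vertices diamond) \<longleftrightarrow> distinct [g 0, g 1, g 2, g 3]" for g :: "nat \<Rightarrow> 'a"
    by (auto simp: diamond_def)
  have "S \<in> copies diamond G \<longleftrightarrow> (\<exists>g :: nat \<Rightarrow> 'a. ?R (g 0) (g 1) (g 2) (g 3))"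
    unfolding copies_eq_image_graphs[OF simple] im inj
    by (auto simp: diamond_on_def adjacent_def)
  also have "\<dots> \<longleftrightarrow> (\<exists>a b c d. ?R a b c d)"
  proof
    assume "\<exists>a b c d. ?R a b c d"
    then obtain a b c d where abcd: "?R a b c d" by blast
    let ?g = "\<lambda>i :: nat. if i = 0 then a else if i = 1 then b else if i = 2 then c else d"
    have "?R (?g 0) (?g 1) (?g 2) (?g 3)" using abcd by simp
    then show "\<exists>g :: nat \<Rightarrow> 'a. ?R (g 0) (g 1) (g 2) (g 3)" by (rule exI[of _ ?g])
  qed blast
  finally show ?thesis .
qed

lemma adjacent_add_edge:
  "adjacent (add_edge G x y) u v \<longleftrightarrow> adjacent G u v \<or> u = x \<and> v = y \<or> u = y \<and> v = x"
  by (auto simp: adjacent_def add_edge_def doubleton_eq_iff)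

lemma simple_graph_adjacent:
  assumes "simple_graph G" "adjacent G u v"
  shows "u \<in> vertices G" "v \<in> vertices G" "u \<noteq> v"
  using assms by (auto simp: simple_graph_def adjacent_def)

text \<open>All pairs of the four vertices other than \<open>b\<close>, \<open>d\<close> are edges,
  so distinctness comes down to \<open>b \<noteq> d\<close>.\<close>

lemma diamond_copyI:
  assumes "simple_graph G" "b \<noteq> d" "adjacent G a b" "adjacent G b c" "adjacent G c d"
    "adjacent G d a" "adjacent G a c"
  shows "diamond_on a b c d \<in> copies diamond G"
proof -
  have "distinct [a, b, c, d]"
    using assms(2) assms(3-7)[THEN simple_graph_adjacent(3)[OF assms(1)]] by auto
  moreover have "{a, b, c, d} \<subseteq> vertices G"
    using assms(3-7)[THEN simple_graph_adjacent(1)[OF assms(1)]] by auto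
  ultimately show ?thesis unfolding copies_diamond_iff using assms(3-7) by blast
qed

section \<open>From unique saturation to the locale\<close>

lemma simple_graph_add_edge:
  "simple_graph G \<Longrightarrow> x \<in> vertices G \<Longrightarrow> y \<in> vertices G \<Longrightarrow> x \<noteq> y \<Longrightarrow> simple_graph (add_edge G x y)"
  by (auto simp: simple_graph_def add_edge_def)

text \<open>Each common-neighbour configuration yields a diamond in \<open>?H\<close>. There is only
  one, \<open>S\<close>, so comparing its vertex set across configurations excludes all
  coexistence.\<close>

lemma saturated_nonadjacent:
  assumes G: "simple_graph G" and sat: "uniquely_saturated diamond G"
    and V: "x \<in> vertices G" "y \<in> vertices G" and ne: "x \<noteq> y" and nadj: "\<not> adjacent G x y"
  defines "C \<equiv> common_neighbors (adjacent G) x y"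
  defines "P \<equiv> triangle_edge (adjacent G)"
  shows "card C = 2 \<and> (\<forall>w \<in> C. \<not> P x w \<and> \<not> P y w) \<or> (\<exists>w. C = {w} \<and> (P x w \<noteq> P y w))"
proof -
  let ?E = "adjacent G" and ?H = "add_edge G x y"
  have no_diamond: "copies diamond G = {}" using sat by (simp add: uniquely_saturated_def)
  have H: "simple_graph ?H" using simple_graph_add_edge[OF G V ne] .
  note adj = adjacent_add_edge[of G x y]
  have sym: "?E u v \<Longrightarrow> ?E v u" for u v using adjacent_commute by metis
  have nadj': "\<not> ?E y x" using nadj sym by blast
  have C: "w \<in> C \<longleftrightarrow> ?E x w \<and> ?E y w" for w by (simp add: C_def common_neighbors_def)
  have C_adj: "?E x w" "?E w x" "?E y w" "?E w y" if "w \<in> C" for w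
    using that sym unfolding C by blast+
  have "card (copies diamond ?H) = 1"
    using sat V ne nadj by (simp add: uniquely_saturated_def)
  then obtain S where S: "copies diamond ?H = {S}" by (auto simp: card_1_singleton_iff)
  have chord: "vertices S = {x, v, y, w}" if "v \<in> C" "w \<in> C" "v \<noteq> w" for v w
  proof -
    have "diamond_on x v y w \<in> copies diamond ?H"
      by (rule diamond_copyI[OF H that(3)])
        (use C_adj[OF that(1)] C_adj[OF that(2)] in \<open>simp_all add: adj\<close>)
    then have "S = diamond_on x v y w" using S by simp
    then show ?thesis by (simp add: diamond_on_def)
  qed
  \<comment> \<open>Here xy is an outer edge of the diamond and xw its chord.\<close>
  have left: "\<exists>z. z \<noteq> x \<and> z \<noteq> y \<and> z \<noteq> w \<and> ?E x z \<and> ?E w z \<and> vertices S = {x, y, w, z}"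
    if w: "w \<in> C" and P: "P x w" for w
  proof -
    obtain z where z: "?E x z" "?E w z" using P unfolding P_def triangle_edge_def by blast
    have ne': "y \<noteq> z" using z nadj by blast
    have "diamond_on x y w z \<in> copies diamond ?H"
      by (rule diamond_copyI[OF H ne'])
        (use C_adj[OF w] z sym[OF z(1)] in \<open>simp_all add: adj\<close>)
    then have "S = diamond_on x y w z" using S by simp
    then have "vertices S = {x, y, w, z}" by (simp add: diamond_on_def)
    moreover have "z \<noteq> x" "z \<noteq> y" "z \<noteq> w" using z ne' z[THEN simple_graph_adjacent(3)[OF G]] by auto
    ultimately show ?thesis using z by (intro exI[of _ z]) simp
  qed
  have right: "\<exists>z. z \<noteq> x \<and> z \<noteq> y \<and> z \<noteq> w \<and> ?E y z \<and> ?E w z \<and> vertices S = {x, y, w, z}"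
    if w: "w \<in> C" and P: "P y w" for w
  proof -
    obtain z where z: "?E y z" "?E w z" using P unfolding P_def triangle_edge_def by blast
    have ne': "x \<noteq> z" using z nadj' by blast
    have "diamond_on y x w z \<in> copies diamond ?H"
      by (rule diamond_copyI[OF H ne'])
        (use C_adj[OF w] z sym[OF z(1)] in \<open>simp_all add: adj\<close>)
    then have "S = diamond_on y x w z" using S by simp
    then have "vertices S = {x, y, w, z}" by (auto simp: diamond_on_def)
    moreover have "z \<noteq> x" "z \<noteq> y" "z \<noteq> w" using z ne' z[THEN simple_graph_adjacent(3)[OF G]] by auto
    ultimately show ?thesis using z by (intro exI[of _ z]) simp
  qed
  have C_ne: "w \<noteq> x \<and> w \<noteq> y" if "w \<in> C" for w
    using that simple_graph_adjacent(3)[OF G] unfolding C by blast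
  have C_indep: "\<not> ?E v w" if "v \<in> C" "w \<in> C" for v w
  proof
    assume vw: "?E v w"
    have "diamond_on v x w y \<in> copies diamond G"
      by (rule diamond_copyI[OF G ne])
        (use C_adj[OF that(1)] C_adj[OF that(2)] vw in simp_all)
    then show False using no_diamond by blast
  qed
  \<comment> \<open>Equal vertex sets force the third triangle vertex to be \<open>w\<close>; then
    vw is an edge and \<open>G\<close> already contains a diamond with that chord.\<close>
  have no_P: "\<not> P x v \<and> \<not> P y v" if "v \<in> C" "w \<in> C" "v \<noteq> w" for v w
  proof -
    have False if P: "P x v \<or> P y v"
    proof -
      obtain z where z: "z \<noteq> x" "z \<noteq> y" "z \<noteq> v" "?E v z" "vertices S = {x, y, v, z}"
        using P left[OF \<open>v \<in> C\<close>] right[OF \<open>v \<in> C\<close>] by blast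
      then have "z = w" using chord[OF \<open>v \<in> C\<close> \<open>w \<in> C\<close> \<open>v \<noteq> w\<close>] C_ne \<open>w \<in> C\<close> by auto
      then show False using C_indep z \<open>v \<in> C\<close> \<open>w \<in> C\<close> by blast
    qed
    then show ?thesis by blast
  qed
  have ex: "(\<exists>v w. v \<in> C \<and> w \<in> C \<and> v \<noteq> w) \<or> (\<exists>w\<in>C. P x w \<or> P y w)"
  proof -
    have "S \<in> copies diamond ?H" using S by simp
    then obtain a b c d where d: "distinct [a, b, c, d]"
      and e: "adjacent ?H a b" "adjacent ?H b c" "adjacent ?H c d" "adjacent ?H d a" "adjacent ?H a c"
      unfolding copies_diamond_iff by blast
    have nG: "\<not> (?E a b \<and> ?E b c \<and> ?E c d \<and> ?E d a \<and> ?E a c)"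
    proof
      assume "?E a b \<and> ?E b c \<and> ?E c d \<and> ?E d a \<and> ?E a c"
      then have "diamond_on a b c d \<in> copies diamond G" using d by (intro diamond_copyI[OF G]) auto
      then show False using no_diamond by blast
    qed
    \<comment> \<open>Handles all four positions of the new edge as an outer edge: \<open>p\<close>
      is its endpoint on the chord, and pr is the chord.\<close>
    have outer: ?thesis if "{p, q} = {x, y}" "?E p r" "?E q r" "?E p s" "?E r s" for p q r s
    proof -
      have "r \<in> C" using that by (auto simp: C doubleton_eq_iff)
      moreover have "P p r" using that unfolding P_def triangle_edge_def by blast
      ultimately show ?thesis using that(1) by (auto simp: doubleton_eq_iff)
    qed
    from nG e consider "{a, c} = {x, y}" | "{a, b} = {x, y}" | "{b, c} = {x, y}"
      | "{c, d} = {x, y}" | "{d, a} = {x, y}"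
      unfolding adj by (auto simp: doubleton_eq_iff)
    then show ?thesis
    proof cases
      case 1
      then have "?E a b" "?E b c" "?E c d" "?E d a" using e d unfolding adj by (auto simp: doubleton_eq_iff)
      then have "b \<in> C" "d \<in> C" using 1 sym unfolding C by (auto simp: doubleton_eq_iff)
      then show ?thesis using d by auto
    next
      case 2
      then have "?E b c" "?E c d" "?E d a" "?E a c" using e d unfolding adj by (auto simp: doubleton_eq_iff)
      then show ?thesis using outer[OF 2, of c d] sym by blast
    next
      case 3
      then have "?E a b" "?E c d" "?E d a" "?E a c" using e d unfolding adj by (auto simp: doubleton_eq_iff)
      moreover have "{c, b} = {x, y}" using 3 by blast
      ultimately show ?thesis using outer[of c b a d] sym by blast
    next
      case 4
      then have "?E a b" "?E b c" "?E d a" "?E a c" using e d unfolding adj by (auto simp: doubleton_eq_iff)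
      then show ?thesis using outer[OF 4, of a b] sym by blast
    next
      case 5
      then have "?E a b" "?E b c" "?E c d" "?E a c" using e d unfolding adj by (auto simp: doubleton_eq_iff)
      moreover have "{a, d} = {x, y}" using 5 by blast
      ultimately show ?thesis using outer[of a d c b] sym by blast
    qed
  qed
  show ?thesis
  proof (cases "\<exists>v w. v \<in> C \<and> w \<in> C \<and> v \<noteq> w")
    case True
    then obtain v w where vw: "v \<in> C" "w \<in> C" "v \<noteq> w" by blast
    have "u = v \<or> u = w" if "u \<in> C" for u
    proof (rule ccontr)
      assume u: "\<not> ?thesis"
      then have "{x, v, y, w} = {x, v, y, u}" using chord[OF vw] chord[OF vw(1) that] by blast
      then show False using u C_ne[OF that] by blast
    qed
    then have "C = {v, w}" using vw by blast
    then show ?thesis using vw no_P by (auto simp: card_2_iff)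
  next
    case False
    then obtain w where w: "w \<in> C" "P x w \<or> P y w" using ex by blast
    then have Cw: "C = {w}" using False by blast
    \<comment> \<open>The two triangles would share their third vertex, a second common neighbour of
      \<open>x\<close> and \<open>y\<close>.\<close>
    have "\<not> (P x w \<and> P y w)"
    proof
      assume "P x w \<and> P y w"
      then obtain z z' where z: "z \<noteq> x" "z \<noteq> y" "z \<noteq> w" "?E x z" "vertices S = {x, y, w, z}"
        and z': "?E y z'" "vertices S = {x, y, w, z'}"
        using left[OF w(1)] right[OF w(1)] by blast
      then have "z = z'" by auto
      then show False using z z' Cw C by blast
    qed
    then show ?thesis using w Cw by blast
  qed
qed

lemma saturated_locale:
  assumes G: "simple_graph G" and sat: "uniquely_saturated diamond G"
  shows "uniquely_diamond_saturated (vertices G) (adjacent G)"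
proof
  show "finite (vertices G)" using G by (simp add: simple_graph_def)
  show "adjacent G x y \<Longrightarrow> adjacent G y x" for x y using adjacent_commute by metis
  show "\<not> adjacent G x x" for x using simple_graph_adjacent(3)[OF G] by blast
  show "adjacent G x y \<Longrightarrow> x \<in> vertices G" for x y by (rule simple_graph_adjacent(1)[OF G])
  show "b = d" if "adjacent G a c" "adjacent G a b" "adjacent G b c" "adjacent G a d" "adjacent G c d"
    for a b c d
  proof (rule ccontr)
    assume "b \<noteq> d"
    then have "diamond_on a b c d \<in> copies diamond G"
      using that by (intro diamond_copyI[OF G]) (auto simp: adjacent_commute)
    then show False using sat by (simp add: uniquely_saturated_def)
  qed
qed (rule saturated_nonadjacent[OF assms])

section \<open>Triangle vertices and the final estimate\<close>

lemma triangle_vertices_eq: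
  assumes G: "simple_graph G"
  shows "triangle_vertices G = {x. \<exists>y. triangle_edge (adjacent G) x y}"
proof (intro equalityI subsetI)
  fix x assume "x \<in> triangle_vertices G"
  then obtain a b c where "x \<in> {a, b, c}" "adjacent G a b" "adjacent G b c" "adjacent G c a"
    unfolding triangle_vertices_def by (auto simp: copies_triangle_iff triangle_on_def)
  moreover have "adjacent G u v \<Longrightarrow> adjacent G v u" for u v using adjacent_commute by metis
  ultimately show "x \<in> {x. \<exists>y. triangle_edge (adjacent G) x y}"
    unfolding triangle_edge_def by blast
next
  fix x assume "x \<in> {x. \<exists>y. triangle_edge (adjacent G) x y}"
  then obtain y z where "adjacent G x y" "adjacent G y z" "adjacent G x z"
    unfolding triangle_edge_def by blast
  then have xyz: "adjacent G x y" "adjacent G y z" "adjacent G z x"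
    by (simp_all add: adjacent_commute[of G z x])
  have "distinct [x, y, z]" "{x, y, z} \<subseteq> vertices G"
    using xyz[THEN simple_graph_adjacent(3)[OF G]] xyz[THEN simple_graph_adjacent(1)[OF G]] by auto
  then have "triangle_on x y z \<in> copies triangle G"
    unfolding copies_triangle_iff using xyz by blast
  then show "x \<in> triangle_vertices G"
    unfolding triangle_vertices_def by (auto simp: triangle_on_def intro!: bexI)
qed

lemma card_triangle_vertices_le:
  assumes "finite (copies triangle G)"
  shows "card (triangle_vertices G) \<le> 3 * card (copies triangle G)"
proof -
  have "card (vertices T) \<le> 3" if "T \<in> copies triangle G" for T
    using that unfolding copies_triangle_iff triangle_on_def by (auto simp: card_insert_if)
  then have "(\<Sum>T\<in>copies triangle G. card (vertices T)) \<le> (\<Sum>T\<in>copies triangle G. 3)"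
    by (rule sum_mono)
  then show ?thesis
    unfolding triangle_vertices_def using card_UN_le[OF assms, of vertices] by simp
qed

theorem theorem3p4:
  fixes G :: "'a graph" and n k :: nat and A :: "'a set" and t :: int
  assumes "simple_graph G"
    and "uniquely_saturated diamond G"
    and "n = card (vertices G)"
    and "k = card (copies triangle G)"
    and "k \<ge> 2"
    and "A = triangle_vertices G"
    and "t = Min {int k - int (card (neighborhood G u \<inter> A)) | u. u \<in> set_neighborhood G A}"
  shows "real n \<le> 1 / 2 * real k ^ 2 + (10 * real_of_int t + 5) / 2 * real k
           + (25 * real_of_int t ^ 2 + 7 * real_of_int t) / 2 + 1"
proof -
  interpret uniquely_diamond_saturated "vertices G" "adjacent G"
    using saturated_locale assms(1,2) .
  let ?E = "adjacent G"
  have A: "A = uniquely_diamond_saturated.A ?E"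
    unfolding assms(6) triangle_vertices_eq[OF assms(1)] A_def ..
  have N: "neighborhood G u = {w. ?E u w}" for u
    using E_in_V2 by (auto simp: neighborhood_def)
  have finite_copies: "finite (copies triangle G)"
    using assms(4,5) card.infinite by fastforce
  have card_A: "card A \<le> 3 * k"
    using card_triangle_vertices_le[OF finite_copies] assms(4,6) by simp
  obtain x y where xy: "x \<in> A" "y \<in> A" "x \<noteq> y" "\<not> triangle_edge ?E x y"
  proof -
    obtain S T where ST: "S \<in> copies triangle G" "T \<in> copies triangle G" "S \<noteq> T"
      using assms(4,5) card_le_Suc0_iff_eq[OF finite_copies] by fastforce
    obtain a b c where S: "S = triangle_on a b c" "distinct [a, b, c]"
      and abc: "?E a b" "?E b c" "?E c a"
      using ST(1) unfolding copies_triangle_iff by blast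
    obtain p q r where T: "T = triangle_on p q r" "distinct [p, q, r]"
      using ST(2) unfolding copies_triangle_iff by blast
    \<comment> \<open>Triangles on the same three vertices are equal as graphs. A vertex
      \<open>y\<close> of the second one outside the first is no triangle neighbour of
      \<open>a\<close>, whose only ones are \<open>b\<close> and \<open>c\<close>.\<close>
    have "\<not> {p, q, r} \<subseteq> {a, b, c}"
      using S T ST(3) by (auto simp: triangle_on_def insert_commute)
    then obtain y where y: "y \<in> {p, q, r}" "y \<notin> {a, b, c}" by blast
    have Pab: "triangle_edge ?E a b" "triangle_edge ?E a c"
      using abc E_sym P_I by blast+
    obtain z where z: "{w. triangle_edge ?E a w} = {b, z}" using P_neighbors[OF Pab(1)] by metis
    then have "z = c" using Pab S(2) by auto
    then have "\<not> triangle_edge ?E a y" using z y by blast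
    moreover have "a \<in> A" unfolding A using Pab P_in_A by blast
    moreover have "y \<in> A"
      unfolding assms(6) triangle_vertices_def using ST(2) T(1) y(1)
      by (intro UN_I[of T]) (auto simp: triangle_on_def)
    moreover have "a \<noteq> y" using y by blast
    ultimately show ?thesis using that by blast
  qed
  \<comment> \<open>With finiteness, this ensures that \<open>Min\<close> is attained, at some
    \<open>u\<close>.\<close>
  have "set_neighborhood G A \<noteq> {}"
    using exists_boundary_vertex[of x y] xy unfolding A set_neighborhood_def by blast
  moreover have "finite (set_neighborhood G A)" using finite_V by (simp add: set_neighborhood_def)
  moreover have "{int k - int (card (neighborhood G u \<inter> A)) | u. u \<in> set_neighborhood G A}
      = (\<lambda>u. int k - int (card (neighborhood G u \<inter> A))) ` set_neighborhood G A" by blast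
  ultimately have "t \<in> (\<lambda>u. int k - int (card (neighborhood G u \<inter> A))) ` set_neighborhood G A"
    unfolding assms(7) by (metis (no_types, lifting) Min_in finite_imageI image_is_empty)
  then obtain u where u: "u \<in> set_neighborhood G A" and t: "t = int k - int (card ({w. ?E u w} \<inter> A))"
    unfolding N by blast
  obtain a where a: "a \<in> A" "?E u a" and uA: "u \<in> vertices G" "u \<notin> A"
    using u E_sym unfolding set_neighborhood_def by blast
  let ?a = "card ({w. ?E u w} \<inter> A)"
  define D where "D = card {w. ?E u w}"
  have ak: "?a \<le> k" using card_A_neighbors_le uA(2) card_A unfolding A by blast
  have "card ({w. ?E u w} - A) \<le> 6 * (k - ?a)"
    using card_outside_neighbors_le[of u a k] uA(2) a card_A unfolding A by blast
  moreover have "D = ?a + card ({w. ?E u w} - A)"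
    unfolding D_def using card_Int_Diff[OF finite_E] by blast
  \<comment> \<open>There are k - t neighbours in \<open>A\<close> and at most 6t outside it;
    \<open>ak\<close> makes the natural subtraction exact.\<close>
  ultimately have "int D \<le> int k + 5 * t" using t ak by linarith
  then have D: "real D \<le> real k + 5 * real_of_int t" by linarith
  have a_t: "real ?a = real k - real_of_int t" using t by linarith
  have t0: "0 \<le> real_of_int t" using t ak by simp
  have "n \<le> 1 + D + (D choose 2) + 2 * ?a"
    using card_V_le[of u] uA unfolding A assms(3) D_def by blast
  then have "real n \<le> 1 + real D + real (D choose 2) + 2 * real ?a" by linarith
  also have "real (D choose 2) = real D * (real D - 1) / 2"
    by (cases D) (auto simp: choose_two real_of_nat_div algebra_simps)
  finally have "real n \<le> 1 + real D * (real D + 1) / 2 + 2 * (real k - real_of_int t)"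
    unfolding a_t by (simp add: field_simps)
  also have "real D * (real D + 1) \<le>
      (real k + 5 * real_of_int t) * (real k + 5 * real_of_int t + 1)"
    by (rule mult_mono) (use D t0 in auto)
  \<comment> \<open>The bound reached has t/2 where the goal has 7t/2; the slack 3t is
    nonnegative.\<close>
  finally show ?thesis using t0 by (simp add: field_simps power2_eq_square)
qed

end
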